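(* Let $\mathcal{U},\mathcal{V}$ be real Hilbert spaces and $b:\mathcal{U}\times\mathcal{V}\to\mathbb{R}$ a bilinear form satisfying Assumption 1 with constants $M$ and $\gamma$. Let $\mathcal{U}_h\subseteq\mathcal{U}$ be a finite-dimensional subspace and $\mathcal{V}_r\subseteq\mathcal{V}$ a closed subspace such that Assumption 4 holds with operator $\Pi_r$. Let $\ell\in\mathrm{Range}(\mathcal{B})$, $\boldsymbol{u}^\star=\mathcal{B}^{-1}\ell$, and let $\boldsymbol{u}_h\in\mathcal{U}_h$ be arbitrary. Denote the best approximation of $\boldsymbol{u}^\star$ in $\mathcal{U}_h$ by $\boldsymbol{u}_h^\star=\arg\min_{\boldsymbol{w}_h\in\mathcal{U}_h}\|\boldsymbol{u}^\star-\boldsymbol{w}_h\|_{\mathcal{U}}$. Then the computable residual $\eta_r(\boldsymbol{u})=\|\ell-\mathcal{B}\boldsymbol{u}\|_{\mathcal{V}_r'}$ and the data approximation error $\mathrm{osc}(\ell)=\|\ell\circ(1-\Pi_r)\|_{\mathcal{V}'}$ satisfy $$\gamma^2\|\boldsymbol{u}^\star-\boldsymbol{u}_h\|_{\mathcal{U}}^2\le\eta_r(\boldsymbol{u}_h)^2+\left(\eta_r(\boldsymbol{u}_h)\sqrt{\|\Pi_r\|^2-1}+\mathrm{osc}(\ell)\right)^2,$$ $$\eta_r(\boldsymbol{u}_h)\le M\|\boldsymbol{u}^\star-\boldsymbol{u}_h\|_{\mathcal{U}},$$ and $$\mathrm{osc}(\ell)\le M\|\Pi_r\|\,\|\bolds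ymbol{u}^\star-\boldsymbol{u}_h^\star\|_{\mathcal{U}}.$$
   Context: Infima and suprema of quotients are over nonzero elements. Assumption 1: $\sup_{\boldsymbol{u}\in\mathcal{U}}\sup_{\boldsymbol{v}\in\mathcal{V}}\frac{b(\boldsymbol{u},\boldsymbol{v})}{\|\boldsymbol{u}\|_{\mathcal{U}}\|\boldsymbol{v}\|_{\mathcal{V}}}=M<\infty$ and $\inf_{\boldsymbol{u}\in\mathcal{U}}\sup_{\boldsymbol{v}\in\mathcal{V}}\frac{b(\boldsymbol{u},\boldsymbol{v})}{\|\boldsymbol{u}\|_{\mathcal{U}}\|\boldsymbol{v}\|_{\mathcal{V}}}=\gamma>0$. The operator $\mathcal{B}:\mathcal{U}\to\mathcal{V}'$ is $\langle\mathcal{B}\boldsymbol{u},\boldsymbol{v}\rangle=b(\boldsymbol{u},\boldsymbol{v})$ (it is injective under Assumption 1, so $\mathcal{B}^{-1}\ell$ makes sense for $\ell\in\mathrm{Range}(\mathcal{B})$). Assumption 4: there is a bounded linear operator $\Pi_r:\mathcal{V}\to\mathcal{V}_r$ (viewed also as a map $\mathcal{V}\to\mathcal{V}$) with $\Pi_r\circ\Pi_r=\Pi_r$ and $b(\boldsymbol{u}_h,\boldsymbol{v}-\Pi_r\boldsymbol{v})=0$ for all $\boldsymbol{u}_h\in\mathcal{U}_h$, $\boldsymbol{v}\in\mathcal{V}$; its range need not be all of $\mathcal{V}_r$. $\|\Pi_r\|$ is the operator norm with respect to $\|\cdot\|_{\mathcal{V}}$. For $F\in\mathcal{V}'$, $\|F\|_{\mathcal{V}'}=\sup_{\boldsymbol{v}\in\mathcal{V}}\frac{|F(\boldsymbol{v})|}{\|\boldsymbol{v}\|_{\mathcal{V}}}$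 and $\|F\|_{\mathcal{V}_r'}=\sup_{\boldsymbol{v}_r\in\mathcal{V}_r}\frac{|F(\boldsymbol{v}_r)|}{\|\boldsymbol{v}_r\|_{\mathcal{V}}}$.
   Formalization: The operator Π_r is assumed nonzero; for Π_r = 0 (which forces U_h = {0}) the square root of ‖Π_r‖² − 1 is undefined and the bound on osc(ℓ) fails for every ℓ ≠ 0. *)

theory Defs
  imports "HOL-Analysis.Analysis"
begin

text \<open>
  Real Hilbert spaces are types of sort \<open>{real_inner, complete_space}\<close>; their subspaces are sets.
\<close>

text \<open>
  The extrema are taken in \<open>ereal\<close>, so that equating them with real constants asserts their
  finiteness. As the empty supremum and infimum are infinite, the condition also excludes
  \<open>U = {0}\<close> and \<open>V = {0}\<close>.
\<close>

definition continuous_inf_sup ::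
  "('u::real_normed_vector \<Rightarrow> 'v::real_normed_vector \<Rightarrow> real) \<Rightarrow> real \<Rightarrow> real \<Rightarrow> bool" where
  "continuous_inf_sup b M \<gamma> \<longleftrightarrow>
     (SUP u\<in>UNIV - {0}. SUP v\<in>UNIV - {0}. ereal (b u v / (norm u * norm v))) = ereal M \<and>
     (INF u\<in>UNIV - {0}. SUP v\<in>UNIV - {0}. ereal (b u v / (norm u * norm v))) = ereal \<gamma> \<and>
     \<gamma> > 0"

text \<open>
  \<open>Blinfun\<close> returns the given function only if that function is bounded linear; for a bilinear
  \<open>b\<close> with \<open>continuous_inf_sup b M \<gamma>\<close> every \<open>b u\<close> is.
\<close>

definition form_operator ::
  "('u::real_normed_vector \<Rightarrow> 'v::real_normed_vector \<Rightarrow> real) \<Rightarrow> 'u \<Rightarrow> ('v \<Rightarrow>\<^sub>L real)" where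
  "form_operator b u = Blinfun (b u)"

definition finite_dim_subspace :: "'a::real_vector set \<Rightarrow> bool" where
  "finite_dim_subspace S \<longleftrightarrow> subspace S \<and> (\<exists>A. finite A \<and> span A = S)"

text \<open>
  Idempotence gives \<open>norm P \<ge> 1\<close> unless \<open>P = 0\<close>. The case \<open>P = 0\<close>, which is possible here and forces
  \<open>Uh = {0}\<close> under the inf-sup condition, has to be excluded where \<open>sqrt ((norm P)\<^sup>2 - 1)\<close> is used,
  since \<open>sqrt\<close> takes negative values on negative arguments.
\<close>

definition fortin_operator ::
  "('u::real_normed_vector \<Rightarrow> 'v::real_normed_vector \<Rightarrow> real) \<Rightarrow> 'u set \<Rightarrow> 'v set \<Rightarrow>
    ('v \<Rightarrow>\<^sub>L 'v) \<Rightarrow> bool" where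
  "fortin_operator b Uh Vr P \<longleftrightarrow>
     range (blinfun_apply P) \<subseteq> Vr \<and>
     P o\<^sub>L P = P \<and>
     (\<forall>w\<in>Uh. \<forall>v. b w (v - blinfun_apply P v) = 0)"

text \<open>
  The norm of the restriction of \<open>F\<close> to the subspace \<open>S\<close>. The supremum is a real one and is
  unspecified for \<open>S = {0}\<close>, which cannot occur for the range space of a nonzero operator.
\<close>

definition dual_norm_on :: "'v::real_normed_vector set \<Rightarrow> ('v \<Rightarrow>\<^sub>L real) \<Rightarrow> real" where
  "dual_norm_on S F = (SUP v\<in>S - {0}. \<bar>blinfun_apply F v\<bar> / norm v)"

definition residual_est ::
  "('u::real_normed_vector \<Rightarrow> 'v::real_normed_vector \<Rightarrow> real) \<Rightarrow> ('v \<Rightarrow>\<^sub>L real) \<Rightarrow> 'v set \<Rightarrow> 'u \<Rightarrow> real"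
  where
  "residual_est b l Vr u = dual_norm_on Vr (l - form_operator b u)"

definition osc :: "('v::real_normed_vector \<Rightarrow>\<^sub>L 'v) \<Rightarrow> ('v \<Rightarrow>\<^sub>L real) \<Rightarrow> real" where
  "osc P l = norm (l o\<^sub>L (id_blinfun - P))"

end

theory Submission
  imports Defs
begin

text \<open>
  Write \<open>e = ustar - uh\<close> and \<open>F = l - form_operator b uh\<close>, so \<open>F v = b e v\<close>. Split \<open>v = w + d\<close>
  with \<open>w \<in> Vr\<close> and \<open>d\<close> orthogonal to \<open>Vr\<close>. Then \<open>F w\<close> is controlled by \<open>\<eta>\<close>, the norm of \<open>F\<close> on
  \<open>Vr\<close>, and \<open>F d = F (P d) + l (d - P d)\<close> because \<open>b uh\<close> annihilates the range of \<open>1 - P\<close>. Since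
  \<open>P d \<in> Vr\<close> is orthogonal to \<open>d\<close>, the norm of \<open>P d\<close> is at most \<open>sqrt ((norm P)\<^sup>2 - 1) * norm d\<close>, and
  Cauchy-Schwarz in the plane bounds the full norm of \<open>F\<close>; the inf-sup condition does the rest.
  For the oscillation, \<open>l (v - P v) = b (ustar - uhstar) (v - P v)\<close>, and \<open>1 - P\<close> has at most the
  norm of \<open>P\<close> (Kato).
\<close>

section \<open>Orthogonal projection onto subspaces\<close>

text \<open>A minimising sequence for the distance from \<open>v\<close> to \<open>S\<close> is
  Cauchy, and moving its limit along \<open>s\<close> cannot shorten the distance, which forces
  orthogonality.\<close>

lemma orthogonal_decomposition_closed:
  fixes S :: "'a::{real_inner, complete_space} set"
  assumes S: "subspace S" and "closed S"
  obtains w where "w \<in> S" and "\<And>s. s \<in> S \<Longrightarrow> (v - w) \<bullet> s = 0"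
proof -
  define D where "D = (INF s\<in>S. (norm (v - s))\<^sup>2)"
  have ne: "S \<noteq> {}" using subspace_0[OF S] by blast
  have bdd: "bdd_below ((\<lambda>s. (norm (v - s))\<^sup>2) ` S)"
    by (rule bdd_belowI2[of _ 0]) simp
  have D_le: "D \<le> (norm (v - s))\<^sup>2" if "s \<in> S" for s
    unfolding D_def by (rule cINF_lower[OF bdd that])
  have "\<exists>s\<in>S. (norm (v - s))\<^sup>2 < D + inverse (real (Suc n))" for n
    using cInf_lessD[of "(\<lambda>s. (norm (v - s))\<^sup>2) ` S" "D + inverse (real (Suc n))"] ne
    by (auto simp: D_def)
  then obtain q where q: "\<And>n. q n \<in> S"
    "\<And>n. (norm (v - q n))\<^sup>2 < D + inverse (real (Suc n))"
    by metis
  \<comment> \<open>Parallelogram law: the midpoint of two near-minimisers lies in \<open>S\<close>, so they are close.\<close>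
  have close: "(norm (q m - q n))\<^sup>2 \<le> 2 * inverse (real (Suc m)) + 2 * inverse (real (Suc n))" for m n
  proof -
    have mem: "(1/2) *\<^sub>R (q m + q n) \<in> S"
      by (intro subspace_scale subspace_add S q)
    have "(norm (q m - q n))\<^sup>2 =
        2 * (norm (v - q m))\<^sup>2 + 2 * (norm (v - q n))\<^sup>2 - 4 * (norm (v - (1/2) *\<^sub>R (q m + q n)))\<^sup>2"
      by (simp add: power2_norm_eq_inner inner_diff inner_add inner_commute algebra_simps)
    with D_le[OF mem] q(2)[of m] q(2)[of n] show ?thesis by linarith
  qed
  have "Cauchy q"
  proof (rule metric_CauchyI)
    fix e :: real assume "0 < e"
    \<comment> \<open>With this choice each of the two terms of \<open>close\<close> is below half
      of the squared \<open>e\<close>.\<close>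
    then obtain N where N: "inverse (real (Suc N)) < e\<^sup>2 / 4"
      using reals_Archimedean[of "e\<^sup>2 / 4"] by auto
    have "dist (q m) (q n) < e" if "m \<ge> N" "n \<ge> N" for m n
    proof -
      have "inverse (real (Suc m)) \<le> inverse (real (Suc N))"
        "inverse (real (Suc n)) \<le> inverse (real (Suc N))"
        using that by (auto intro!: le_imp_inverse_le)
      with close[of m n] N have "(norm (q m - q n))\<^sup>2 < e\<^sup>2" by linarith
      then show ?thesis using \<open>0 < e\<close> by (simp add: dist_norm power2_less_imp_less)
    qed
    then show "\<exists>N. \<forall>m\<ge>N. \<forall>n\<ge>N. dist (q m) (q n) < e" by blast
  qed
  then obtain w where w: "q \<longlonglongrightarrow> w"
    using Cauchy_convergent convergent_def by blast
  have wS: "w \<in> S"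
    using closed_sequentially[OF \<open>closed S\<close> _ w] q(1) by blast
  have "(\<lambda>n. (norm (v - q n))\<^sup>2) \<longlonglongrightarrow> (norm (v - w))\<^sup>2"
    by (intro tendsto_intros w)
  moreover have "(\<lambda>n. D + inverse (real (Suc n))) \<longlonglongrightarrow> D + 0"
    by (intro tendsto_intros LIMSEQ_inverse_real_of_nat)
  ultimately have wD: "(norm (v - w))\<^sup>2 \<le> D + 0"
    by (rule LIMSEQ_le) (use q(2) in \<open>auto intro: less_imp_le\<close>)
  have "(v - w) \<bullet> s = 0" if "s \<in> S" for s
  proof (cases "s = 0")
    case False
    \<comment> \<open>This \<open>t\<close> minimises the quadratic
      \<open>norm (v - w - t *\<^sub>R s)\<close> squared.\<close>
    define t where "t = ((v - w) \<bullet> s) / (s \<bullet> s)"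
    have ss: "s \<bullet> s > 0" using False by simp
    have "(norm (v - w))\<^sup>2 \<le> (norm (v - (w + t *\<^sub>R s)))\<^sup>2"
      using wD D_le[OF subspace_add[OF S wS subspace_scale[OF S that]], of t] by linarith
    also have "\<dots> = (norm (v - w))\<^sup>2 - 2 * t * ((v - w) \<bullet> s) + t * t * (s \<bullet> s)"
      by (simp add: power2_norm_eq_inner inner_diff inner_add inner_commute algebra_simps)
    also have "\<dots> = (norm (v - w))\<^sup>2 - ((v - w) \<bullet> s)\<^sup>2 / (s \<bullet> s)"
      using ss by (simp add: t_def power2_eq_square)
    finally have "((v - w) \<bullet> s)\<^sup>2 / (s \<bullet> s) \<le> 0" by simp
    then have "((v - w) \<bullet> s)\<^sup>2 \<le> 0" using ss by (simp add: divide_le_0_iff)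
    then show ?thesis by simp
  qed simp
  with wS that show ?thesis by blast
qed

text \<open>Gram-Schmidt: \<open>a - p\<close> is the one new direction, and \<open>w\<close> is
  corrected along it. The induction hypothesis serves both \<open>a\<close> and \<open>u\<close>,
  hence the generalisation over \<open>u\<close>.\<close>

lemma orthogonal_decomposition_finite_span:
  fixes A :: "'a::real_inner set"
  assumes "finite A"
  shows "\<exists>w\<in>span A. \<forall>s\<in>span A. (u - w) \<bullet> s = 0"
  using assms
proof (induction A arbitrary: u rule: finite_induct)
  case (insert a A)
  obtain p where p: "p \<in> span A" "\<forall>s\<in>span A. (a - p) \<bullet> s = 0" using insert.IH by blast
  obtain w where w: "w \<in> span A" "\<forall>s\<in>span A. (u - w) \<bullet> s = 0" using insert.IH by blast
  define c where "c = ((u - w) \<bullet> (a - p)) / ((a - p) \<bullet> (a - p))"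
  have sub: "span A \<subseteq> span (insert a A)" by (intro span_mono) blast
  have mem: "w + c *\<^sub>R (a - p) \<in> span (insert a A)"
    using subsetD[OF sub] p(1) w(1) by (simp add: span_add span_scale span_diff span_base)
  \<comment> \<open>If \<open>a = p\<close>, division by zero makes \<open>c = 0\<close> and both
    sides vanish.\<close>
  have c: "c * ((a - p) \<bullet> (a - p)) = (u - w) \<bullet> (a - p)"
    by (cases "a - p = 0") (simp_all add: c_def)
  have "(u - (w + c *\<^sub>R (a - p))) \<bullet> s = 0" if s_mem: "s \<in> span (insert a A)" for s
  proof -
    obtain k where k: "s - k *\<^sub>R a \<in> span A" using s_mem span_breakdown_eq by blast
    define r where "r = s - k *\<^sub>R a + k *\<^sub>R p"
    have r: "r \<in> span A" unfolding r_def using k p(1) by (intro span_add span_scale)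
    have s: "s = r + k *\<^sub>R (a - p)" by (simp add: r_def algebra_simps)
    have "(u - (w + c *\<^sub>R (a - p))) \<bullet> s
        = (u - w) \<bullet> r - c * ((a - p) \<bullet> r)
          + k * ((u - w) \<bullet> (a - p) - c * ((a - p) \<bullet> (a - p)))"
      unfolding s by (simp add: inner_diff inner_add algebra_simps)
    then show ?thesis using r p(2) w(2) c by simp
  qed
  with mem show ?case by blast
qed simp

text \<open>The choice behind \<open>arg_min\<close> is sure to land in \<open>S\<close> once some
  minimiser exists; by Pythagoras the orthogonal projection is one.\<close>

lemma arg_min_norm_in_finite_dim_subspace:
  fixes S :: "'a::real_inner set"
  assumes "finite_dim_subspace S"
  shows "arg_min (\<lambda>w. norm (u - w)) (\<lambda>w. w \<in> S) \<in> S"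
proof -
  obtain A where S: "subspace S" and A: "finite A" "span A = S"
    using assms by (auto simp: finite_dim_subspace_def)
  obtain w where w: "w \<in> S" "\<forall>s\<in>S. (u - w) \<bullet> s = 0"
    using orthogonal_decomposition_finite_span[OF A(1)] A(2) by blast
  have "norm (u - w) \<le> norm (u - y)" if "y \<in> S" for y
  proof -
    have "(u - w) \<bullet> (w - y) = 0" using w S that subspace_diff by blast
    then have "(norm (u - y))\<^sup>2 = (norm (u - w))\<^sup>2 + (norm (w - y))\<^sup>2"
      by (simp add: power2_norm_eq_inner inner_diff inner_commute algebra_simps)
    then have "(norm (u - w))\<^sup>2 \<le> (norm (u - y))\<^sup>2" by simp
    then show ?thesis by (rule power2_le_imp_le) (rule norm_ge_zero)
  qed
  then have "is_arg_min (\<lambda>w. norm (u - w)) (\<lambda>w. w \<in> S) w"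
    using w(1) by (auto simp: is_arg_min_def not_less)
  then have "is_arg_min (\<lambda>w. norm (u - w)) (\<lambda>w. w \<in> S) (arg_min (\<lambda>w. norm (u - w)) (\<lambda>w. w \<in> S))"
    unfolding arg_min_def by (rule someI)
  then show ?thesis by (simp add: is_arg_min_def)
qed

section \<open>Norm bounds for idempotent operators\<close>

lemma blinfun_idem_apply:
  assumes "P o\<^sub>L P = P"
  shows "blinfun_apply P (blinfun_apply P v) = blinfun_apply P v"
  using arg_cong[OF assms, of "\<lambda>Q. blinfun_apply Q v"] by simp

lemma norm_idem_ge_1:
  fixes P :: "'v::real_normed_vector \<Rightarrow>\<^sub>L 'v"
  assumes "P o\<^sub>L P = P" and "P \<noteq> 0"
  shows "1 \<le> norm P"
proof -
  obtain v where v: "blinfun_apply P v \<noteq> 0"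
    using \<open>P \<noteq> 0\<close> by (metis blinfun_eqI zero_blinfun.rep_eq)
  have "norm (blinfun_apply P v) \<le> norm P * norm (blinfun_apply P v)"
    using norm_blinfun[of P "blinfun_apply P v"] blinfun_idem_apply[OF assms(1)] by simp
  then show ?thesis using v by simp
qed

text \<open>
  The vector \<open>s *\<^sub>R P v + t *\<^sub>R (v - P v)\<close>, with \<open>s\<close> and \<open>t\<close> chosen to swap the lengths of the two
  components, has the same norm as \<open>v\<close>.
\<close>

lemma norm_complement_idem_le:
  fixes P :: "'v::real_inner \<Rightarrow>\<^sub>L 'v"
  assumes idem: "P o\<^sub>L P = P" and "P \<noteq> 0"
  shows "norm (v - blinfun_apply P v) \<le> norm P * norm v"
proof -
  define x y where "x = blinfun_apply P v" and "y = v - blinfun_apply P v"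
  have Px: "blinfun_apply P x = x" and Py: "blinfun_apply P y = 0" and v: "v = x + y"
    by (simp_all add: x_def y_def blinfun_idem_apply[OF idem] blinfun.diff_right)
  have p1: "1 \<le> norm P" by (rule norm_idem_ge_1[OF assms])
  consider "x = 0" | "y = 0" | "x \<noteq> 0" "y \<noteq> 0" by blast
  then have "norm y \<le> norm P * norm v"
  proof cases
    case 1
    then show ?thesis using p1 mult_right_mono[OF p1, of "norm v"] v by simp
  next
    case 2
    then show ?thesis by simp
  next
    case 3
    define z where "z = (norm y / norm x) *\<^sub>R x + (norm x / norm y) *\<^sub>R y"
    \<comment> \<open>The two scale factors are mutually inverse, so the cross term is the same as
      for \<open>v\<close>.\<close>
    have "(norm z)\<^sup>2 = (norm y / norm x)\<^sup>2 * (norm x)\<^sup>2 + (norm x / norm y)\<^sup>2 * (norm y)\<^sup>2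
        + 2 * ((norm y / norm x) * (norm x / norm y)) * (x \<bullet> y)"
      by (simp only: power2_norm_eq_inner z_def)
        (simp add: inner_add inner_commute power2_eq_square algebra_simps)
    also have "\<dots> = (norm v)\<^sup>2"
      using 3 by (simp add: power_divide)
        (simp add: v power2_norm_eq_inner inner_add inner_commute)
    finally have nz: "norm z = norm v" by simp
    have "blinfun_apply P z = (norm y / norm x) *\<^sub>R x"
      by (simp add: z_def blinfun.add_right blinfun.scaleR_right Px Py)
    then have "norm (blinfun_apply P z) = norm y" using 3 by simp
    then show ?thesis using norm_blinfun[of P z] nz by simp
  qed
  then show ?thesis by (simp add: y_def)
qed

text \<open>
  The bound \<open>norm (P z) \<le> norm P * norm z\<close> is optimised along \<open>z = d + t *\<^sub>R P d\<close>; the best choice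
  is \<open>t = (norm d / norm (P d))\<^sup>2\<close>.
\<close>

lemma norm_idem_orthogonal_le:
  fixes P :: "'v::real_inner \<Rightarrow>\<^sub>L 'v"
  assumes idem: "P o\<^sub>L P = P" and orth: "d \<bullet> blinfun_apply P d = 0"
    and p1: "1 \<le> norm P"
  shows "norm (blinfun_apply P d) \<le> sqrt ((norm P)\<^sup>2 - 1) * norm d"
proof (cases "blinfun_apply P d = 0")
  case True
  then show ?thesis using p1 by simp
next
  case False
  define w where "w = blinfun_apply P d"
  define a c where "a = (norm w)\<^sup>2" and "c = (norm d)\<^sup>2"
  have a: "a > 0" using False by (simp add: a_def w_def)
  have c: "c > 0" using False by (auto simp: c_def)
  have P: "blinfun_apply P (d + (c / a) *\<^sub>R w) = (1 + c / a) *\<^sub>R w"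
    by (simp add: w_def blinfun.add_right blinfun.scaleR_right blinfun_idem_apply[OF idem]
        scaleR_add_left)
  have "(norm (d + (c / a) *\<^sub>R w))\<^sup>2 = c + (c / a)\<^sup>2 * a"
    using orth by (simp only: power2_norm_eq_inner a_def c_def w_def[symmetric])
      (simp add: inner_add inner_commute power2_eq_square)
  moreover have "(norm ((1 + c / a) *\<^sub>R w))\<^sup>2 = (1 + c / a)\<^sup>2 * a"
    by (simp add: a_def power_mult_distrib)
  moreover have "(norm ((1 + c / a) *\<^sub>R w))\<^sup>2 \<le> (norm P)\<^sup>2 * (norm (d + (c / a) *\<^sub>R w))\<^sup>2"
    using norm_blinfun[of P "d + (c / a) *\<^sub>R w"] unfolding P
    by (metis norm_ge_zero power_mono power_mult_distrib)
  ultimately have "(1 + c / a)\<^sup>2 * a \<le> (norm P)\<^sup>2 * (c + (c / a)\<^sup>2 * a)" by simp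
  moreover have "(1 + c / a)\<^sup>2 * a = (1 + c / a) * (a + c)"
    "c + (c / a)\<^sup>2 * a = (1 + c / a) * c"
    using a by (simp_all add: power2_eq_square field_simps)
  \<comment> \<open>The choice of \<open>t\<close> leaves the same positive factor on both sides,
    ready to be cancelled.\<close>
  ultimately have "(1 + c / a) * (a + c) \<le> (1 + c / a) * ((norm P)\<^sup>2 * c)"
    by (simp add: ac_simps)
  then have "a + c \<le> (norm P)\<^sup>2 * c"
    using a c by (simp add: add_pos_pos mult_le_cancel_left_pos)
  then have "a \<le> ((norm P)\<^sup>2 - 1) * c" by (simp add: algebra_simps)
  then have "sqrt a \<le> sqrt (((norm P)\<^sup>2 - 1) * c)" by simp
  then show ?thesis by (simp add: a_def c_def w_def real_sqrt_mult)
qed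

section \<open>Dual norms and the constants of the form\<close>

text \<open>The operator norm of \<open>F\<close> bounds the real supremum. If
  \<open>S = {0}\<close>, the unspecified value is multiplied by zero.\<close>

lemma blinfun_le_dual_norm_on:
  assumes "v \<in> S" and "subspace S"
  shows "\<bar>blinfun_apply F v\<bar> \<le> dual_norm_on S F * norm v"
proof (cases "v = 0")
  case False
  have "bdd_above ((\<lambda>v. \<bar>blinfun_apply F v\<bar> / norm v) ` (S - {0}))"
    using norm_blinfun[of F] by (intro bdd_aboveI2[of _ _ "norm F"]) (simp add: divide_le_eq)
  then have "\<bar>blinfun_apply F v\<bar> / norm v \<le> dual_norm_on S F"
    unfolding dual_norm_on_def using assms False by (intro cSUP_upper) auto
  then show ?thesis using False by (simp add: divide_le_eq)
qed (simp add: blinfun.zero_right)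

lemma dual_norm_on_le:
  assumes "S - {0} \<noteq> {}" and "\<And>v. v \<in> S \<Longrightarrow> \<bar>blinfun_apply F v\<bar> \<le> C * norm v"
  shows "dual_norm_on S F \<le> C"
  unfolding dual_norm_on_def using assms by (intro cSUP_least) (auto simp: divide_le_eq)

text \<open>The quotients are signed; the absolute value comes from replacing \<open>v\<close> by
  \<open>- v\<close>.\<close>

lemma continuous_inf_sup_upper:
  assumes b: "bilinear b" and "continuous_inf_sup b M \<gamma>"
  shows "\<bar>b u v\<bar> \<le> M * norm u * norm v"
proof -
  have le: "b u v \<le> M * norm u * norm v" for u v
  proof (cases "u = 0 \<or> v = 0")
    case True
    then show ?thesis using b by (auto simp: bilinear_lzero bilinear_rzero)
  next
    case False
    have "ereal (b u v / (norm u * norm v)) \<le>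
        (SUP u\<in>UNIV - {0}. SUP v\<in>UNIV - {0}. ereal (b u v / (norm u * norm v)))"
      using False by (intro SUP_upper2[of u] SUP_upper) auto
    then have "b u v / (norm u * norm v) \<le> M"
      using assms(2) by (simp add: continuous_inf_sup_def)
    then show ?thesis using False by (simp add: divide_le_eq mult.assoc)
  qed
  show ?thesis using le[of u v] le[of u "- v"] b by (simp add: bilinear_rneg abs_le_iff)
qed

text \<open>Any bound on the functional \<open>b u\<close> dominates the inner supremum, hence the
  infimum. The sign of \<open>C\<close> settles \<open>u = 0\<close>.\<close>

lemma continuous_inf_sup_lower:
  assumes "bilinear b" and "continuous_inf_sup b M \<gamma>"
    and "0 \<le> C" and C: "\<And>v. b u v \<le> C * norm v"
  shows "\<gamma> * norm u \<le> C"
proof (cases "u = 0")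
  case False
  have "ereal \<gamma> = (INF u\<in>UNIV - {0}. SUP v\<in>UNIV - {0}. ereal (b u v / (norm u * norm v)))"
    using assms(2) by (simp add: continuous_inf_sup_def)
  also have "\<dots> \<le> (SUP v\<in>UNIV - {0}. ereal (b u v / (norm u * norm v)))"
    using False by (intro INF_lower) auto
  also have "\<dots> \<le> ereal (C / norm u)"
    using C False by (intro SUP_least) (simp add: field_simps)
  finally show ?thesis using False by (simp add: field_simps)
qed (use assms in simp)

lemma form_operator_apply:
  assumes b: "bilinear b" and "continuous_inf_sup b M \<gamma>"
  shows "blinfun_apply (form_operator b u) v = b u v"
proof -
  have "bounded_linear (b u)"
  proof (intro bounded_linear_intro)
    show "norm (b u v) \<le> norm v * (M * norm u)" for v
      using continuous_inf_sup_upper[OF assms, of u v] by (simp add: ac_simps)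
  qed (use b in \<open>simp_all add: bilinear_radd bilinear_rmul\<close>)
  then show ?thesis by (simp add: form_operator_def bounded_linear_Blinfun_apply)
qed

text \<open>Lagrange's identity: the defect is the square of \<open>x * t - y * s\<close>.\<close>

lemma cauchy_schwarz_plane:
  fixes x y s t :: real
  shows "x * s + y * t \<le> sqrt (x\<^sup>2 + y\<^sup>2) * sqrt (s\<^sup>2 + t\<^sup>2)"
proof -
  have "(x * s + y * t)\<^sup>2 + (x * t - y * s)\<^sup>2 = (x\<^sup>2 + y\<^sup>2) * (s\<^sup>2 + t\<^sup>2)"
    by (simp add: power2_eq_square algebra_simps)
  then have "(x * s + y * t)\<^sup>2 \<le> (x\<^sup>2 + y\<^sup>2) * (s\<^sup>2 + t\<^sup>2)"
    by (metis le_add_same_cancel1 zero_le_power2)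
  then show ?thesis by (metis real_le_rsqrt real_sqrt_mult)
qed

section \<open>Error, residual and oscillation bounds\<close>

theorem theorem6p4:
  fixes b :: "'u::{real_inner, complete_space} \<Rightarrow> 'v::{real_inner, complete_space} \<Rightarrow> real"
    and M \<gamma> :: real
    and Uh :: "'u set" and Vr :: "'v set"
    and P :: "'v \<Rightarrow>\<^sub>L 'v" and l :: "'v \<Rightarrow>\<^sub>L real"
    and ustar uh uhstar :: 'u
  assumes "bilinear b"
    and "continuous_inf_sup b M \<gamma>"
    and "finite_dim_subspace Uh"
    and "subspace Vr" and "closed Vr"
    and "fortin_operator b Uh Vr P" and "P \<noteq> 0"
    and "l \<in> range (form_operator b)"
    and "ustar = inv (form_operator b) l"
    and "uh \<in> Uh"
    and "uhstar = arg_min (\<lambda>w. norm (ustar - w)) (\<lambda>w. w \<in> Uh)"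
  shows "\<gamma>\<^sup>2 * (norm (ustar - uh))\<^sup>2
           \<le> (residual_est b l Vr uh)\<^sup>2
             + (residual_est b l Vr uh * sqrt ((norm P)\<^sup>2 - 1) + osc P l)\<^sup>2
       \<and> residual_est b l Vr uh \<le> M * norm (ustar - uh)
       \<and> osc P l \<le> M * norm P * norm (ustar - uhstar)"
proof (intro conjI)
  note [simp] = form_operator_apply[OF assms(1,2)]
  note upper = continuous_inf_sup_upper[OF assms(1,2)]
  define \<eta> where "\<eta> = residual_est b l Vr uh"
  define F where "F = l - form_operator b uh"
  have P: "\<And>v. blinfun_apply P v \<in> Vr" "P o\<^sub>L P = P"
    "\<And>w v. w \<in> Uh \<Longrightarrow> b w (v - blinfun_apply P v) = 0"
    using assms(6) by (auto simp: fortin_operator_def)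
  have p1: "1 \<le> norm P" by (rule norm_idem_ge_1[OF P(2) assms(7)])
  \<comment> \<open>Membership of \<open>l\<close> in the range makes \<open>inv\<close> return a
    preimage.\<close>
  have l: "blinfun_apply l v = b ustar v" for v
    using f_inv_into_f[OF assms(8)] assms(9) by (metis form_operator_apply[OF assms(1,2)])
  have F: "blinfun_apply F v = b (ustar - uh) v" for v
    using assms(1) by (simp add: F_def blinfun.diff_left l bilinear_lsub)
  \<comment> \<open>This vector makes the supremum defining \<eta> range over a nonempty set, and
    testing with it yields the signs of \<eta> and of products with \<open>M\<close>.\<close>
  obtain v0 where v0: "v0 \<in> Vr - {0}"
    using P(1) assms(7) by (metis DiffI blinfun_eqI singletonD zero_blinfun.rep_eq)
  have \<eta>: "\<bar>blinfun_apply F v\<bar> \<le> \<eta> * norm v" if "v \<in> Vr" for v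
    using blinfun_le_dual_norm_on[OF that assms(4)] by (simp add: \<eta>_def residual_est_def F_def)
  have "0 \<le> \<eta> * norm v0" using \<eta>[of v0] v0 by auto
  then have \<eta>0: "0 \<le> \<eta>" using v0 by (simp add: zero_le_mult_iff)
  have osc0: "0 \<le> osc P l" by (simp add: osc_def)
  have osc: "\<bar>blinfun_apply l (v - blinfun_apply P v)\<bar> \<le> osc P l * norm v" for v
    using norm_blinfun[of "l o\<^sub>L (id_blinfun - P)" v] by (simp add: osc_def blinfun.diff_left)
  define K where "K = \<eta> * sqrt ((norm P)\<^sup>2 - 1) + osc P l"
  have "blinfun_apply F v \<le> sqrt (\<eta>\<^sup>2 + K\<^sup>2) * norm v" for v
  proof -
    obtain w where w: "w \<in> Vr" "\<And>s. s \<in> Vr \<Longrightarrow> (v - w) \<bullet> s = 0"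
      using orthogonal_decomposition_closed[OF assms(4,5)] by blast
    define d where "d = v - w"
    have nv: "norm v = sqrt ((norm w)\<^sup>2 + (norm d)\<^sup>2)"
      using w(2)[OF w(1)]
      by (simp only: power2_norm_eq_inner d_def norm_eq_sqrt_inner[of v])
        (simp add: inner_diff inner_commute)
    have "blinfun_apply F (blinfun_apply P d) \<le> \<eta> * norm (blinfun_apply P d)"
      using \<eta>[OF P(1), of d] by linarith
    also have "\<dots> \<le> \<eta> * (sqrt ((norm P)\<^sup>2 - 1) * norm d)"
      using w(2) P p1 \<eta>0 by (intro mult_left_mono norm_idem_orthogonal_le) (auto simp: d_def)
    finally have "blinfun_apply F (blinfun_apply P d) \<le> \<eta> * (sqrt ((norm P)\<^sup>2 - 1) * norm d)" .
    moreover have "blinfun_apply F (d - blinfun_apply P d) \<le> osc P l * norm d"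
      using osc[of d] P(3)[OF assms(10), of d] by (simp add: F_def blinfun.diff_left)
    moreover have "blinfun_apply F d
        = blinfun_apply F (blinfun_apply P d) + blinfun_apply F (d - blinfun_apply P d)"
      by (simp add: blinfun.diff_right)
    ultimately have "blinfun_apply F d \<le> K * norm d" by (simp add: K_def algebra_simps)
    moreover have "blinfun_apply F v = blinfun_apply F w + blinfun_apply F d"
      by (simp add: d_def blinfun.diff_right)
    ultimately have "blinfun_apply F v \<le> \<eta> * norm w + K * norm d"
      using \<eta>[OF w(1)] by linarith
    \<comment> \<open>Pairs the vectors \<open>(\<eta>, K)\<close> and
      \<open>(norm w, norm d)\<close>.\<close>
    also have "\<dots> \<le> sqrt (\<eta>\<^sup>2 + K\<^sup>2) * norm v"
      unfolding nv by (rule cauchy_schwarz_plane)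
    finally show ?thesis .
  qed
  then have "\<gamma> * norm (ustar - uh) \<le> sqrt (\<eta>\<^sup>2 + K\<^sup>2)"
    by (intro continuous_inf_sup_lower[OF assms(1,2)]) (simp_all add: F)
  moreover have "0 \<le> \<gamma> * norm (ustar - uh)"
    using assms(2) by (simp add: continuous_inf_sup_def)
  ultimately have "(\<gamma> * norm (ustar - uh))\<^sup>2 \<le> (sqrt (\<eta>\<^sup>2 + K\<^sup>2))\<^sup>2"
    by (intro power_mono)
  then show "\<gamma>\<^sup>2 * (norm (ustar - uh))\<^sup>2
      \<le> (residual_est b l Vr uh)\<^sup>2
        + (residual_est b l Vr uh * sqrt ((norm P)\<^sup>2 - 1) + osc P l)\<^sup>2"
    by (simp add: power_mult_distrib \<eta>_def K_def)
  show "residual_est b l Vr uh \<le> M * norm (ustar - uh)"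
    unfolding residual_est_def F_def[symmetric]
    using v0 upper by (intro dual_norm_on_le) (auto simp: F)
  have mem: "uhstar \<in> Uh"
    unfolding assms(11) by (rule arg_min_norm_in_finite_dim_subspace[OF assms(3)])
  \<comment> \<open>The sign is read off from the continuity bound, whose left side is an absolute
    value.\<close>
  have "0 \<le> M * norm (ustar - uhstar) * norm v0"
    using upper[of "ustar - uhstar" v0] by linarith
  then have M0: "0 \<le> M * norm (ustar - uhstar)"
    using v0 by (simp add: zero_le_mult_iff)
  have "norm (blinfun_apply (l o\<^sub>L (id_blinfun - P)) v)
      \<le> M * norm P * norm (ustar - uhstar) * norm v" for v
  proof -
    have "blinfun_apply (l o\<^sub>L (id_blinfun - P)) v = b (ustar - uhstar) (v - blinfun_apply P v)"
      using P(3)[OF mem, of v] assms(1) by (simp add: l blinfun.diff_left bilinear_lsub)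
    then have "norm (blinfun_apply (l o\<^sub>L (id_blinfun - P)) v)
        \<le> M * norm (ustar - uhstar) * norm (v - blinfun_apply P v)"
      using upper by simp
    also have "\<dots> \<le> M * norm (ustar - uhstar) * (norm P * norm v)"
      by (intro mult_left_mono M0 norm_complement_idem_le P(2) assms(7))
    finally show ?thesis by (simp add: ac_simps)
  qed
  moreover have "0 \<le> M * norm P * norm (ustar - uhstar)"
    using mult_nonneg_nonneg[OF M0 norm_ge_zero[of P]] by (simp add: ac_simps)
  ultimately show "osc P l \<le> M * norm P * norm (ustar - uhstar)"
    unfolding osc_def by (intro norm_blinfun_bound)
qed

end
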